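(* Let $\alpha>0$, $\gamma>0$. Let $\kappa$ be a fragmentation kernel for which there exists an interval $I\subset(0,\infty)$ such that $\kappa$ and the function $x\mapsto s^{-1}x^s\kappa(x)$ are absolutely continuous functions of $x\in[0,1]$ for all $s\in\mathbb C$ with $\Re e(s)\in I$. Let the initial datum be a non-negative function $\mu_0\equiv u_0$ with $\operatorname{supp}(u_0)\subset[0,L]$ and $u_0\in\mathcal C^3([0,L])$, such that either $u_0(L)>0$, or $u_0(L)=0$ and $u_0'(L)<0$. Then for all $T>0$ and $\tau_0>0$ there is a constant $C=C(L,T,\tau_0,\alpha,\gamma)$ such that $$\Big|\mathrm{Var}\big[\tfrac{\kappa}{2}\big]-\big(\mathrm{Var}\big[\tfrac{\kappa}{2}\big]\big)^{est}(t,\Delta\tau)\Big|\le C\,\alpha\,\Delta\tau\qquad\forall t\in(0,T),\ \forall\Delta\tau\in(0,\tau_0).$$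
   Context: $\mathbb R^+=[0,\infty)$. $\mathcal M(\mathbb R^+)$ is the space of (finite, signed) Radon measures supported in $\mathbb R^+$ with the total variation norm; $\mathcal M^+(\mathbb R^+)$ is the subset of non-negative measures. Fragmentation kernel: $\kappa\in\mathcal M^+(\mathbb R^+)$ with no atom at $0$ nor at $1$, $\operatorname{supp}(\kappa)\subset[0,1]$, $\int_0^1 d\kappa(z)=N<+\infty$, $\int_0^1 z\,d\kappa(z)=1$. When $\kappa$ is absolutely continuous, $\kappa$ also denotes its density on $[0,1]$. The initial measure $\mu_0$ has density $u_0$ on $[0,L]$. Fragmentation equation (formally): $\partial_t\mu_t(x)=-\alpha x^\gamma\mu_t(x)+\alpha\int_x^\infty\kappa(x/y)\,y^{\gamma-1}d\mu_t(y)$, $\mu_{t=0}=\mu_0$. A measure-valued solution is a narrowly continuous family $(\mu_t)_{t\ge0}\subset\mathcal M(\mathbb R^+)$ such that, for all $\varphi\in\mathcal C(\mathbb R^+)$ with $x\mapsto\varphi(x)/(1+x)$ bounded and all $t\ge0$, $$\int\varphi\,d\mu_t=\int\varphi\,d\mu_0+\int_0^t ds\int d\mu_s(x)\,\alpha x^\gamma\Big(-\varphi(x)+\int_0^1 d\kappa(z)\varphi(xz)\Big).$$ For compactly supported $\mu_0\in\mathcal M^+(\mathbb R^+)$ there is a unique non-negative such solution in $\mathcal C(\mathbb R^+,(\mathcal M(\mathbb R^+),\|\cdot\|_{TV}))$, denoted $\mu_t$. Mellin transforms: $$U(t,s)=\int_0^{\infty}x^{s-1}d\mu_t(x),\quad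 K(s)=\int_0^\infty z^{s-1}d\kappa(z),\quad W(t,h,s)=\int_0^\infty x^{s-1}e^{-\alpha hx^\gamma}d\mu_t(x)\quad(t\ge0,\ h>0),$$ and $$K^{est}(s,t,\Delta\tau)=\frac{U(t+\Delta\tau,s)-W(t,\Delta\tau,s)}{\alpha\Delta\tau\,U(t,s+\gamma)}.$$ Variance and its estimate: $$\mathrm{Var}\big[\tfrac\kappa2\big]=\tfrac12K(3)-\tfrac14,\qquad \big(\mathrm{Var}\big[\tfrac\kappa2\big]\big)^{est}(t,\Delta\tau)=\tfrac12K^{est}(3,t,\Delta\tau)-\tfrac14$$ (when $N=2$, $\frac12K(3)-\frac14=\frac12\int_0^1|x-\frac12|^2\kappa(x)\,dx$). *)

theory Defs
  imports "HOL-Analysis.Analysis"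
begin

(* Non-negative finite Borel measures on the line carried by [0,\<infinity>); on the real line every
   finite Borel measure is Radon.  For a closed set A, supp M \<subseteq> A means that the complement
   of A is an M-null set. *)
definition radon_plus :: "real measure set" where
  "radon_plus = {M. sets M = sets borel \<and> finite_measure M \<and> emeasure M (- {0..}) = 0}"

(* Total variation norm of the signed measure M - N, as the supremum over finite families of
   pairwise disjoint Borel sets; the supremum is finite for finite measures. *)
definition tv_dist :: "real measure \<Rightarrow> real measure \<Rightarrow> real" where
  "tv_dist M N =
     (SUP P \<in> {P. finite P \<and> P \<subseteq> sets borel \<and> disjoint P}.
        \<Sum>A\<in>P. \<bar>measure M A - measure N A\<bar>)"

definition fragmentation_kernel :: "real measure \<Rightarrow> bool" where
  "fragmentation_kernel \<kappa> \<longleftrightarrow>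
     \<kappa> \<in> radon_plus \<and> emeasure \<kappa> (- {0..1}) = 0 \<and>
     emeasure \<kappa> {0} = 0 \<and> emeasure \<kappa> {1} = 0 \<and>
     (LINT z:{0..1}|\<kappa>. z) = 1"

definition test_function :: "(real \<Rightarrow> real) \<Rightarrow> bool" where
  "test_function \<phi> \<longleftrightarrow>
     continuous_on {0..} \<phi> \<and> bounded ((\<lambda>x. \<phi> x / (1 + x)) ` {0..})"

definition frag_integrand ::
  "real \<Rightarrow> real \<Rightarrow> real measure \<Rightarrow> (real \<Rightarrow> real) \<Rightarrow> real \<Rightarrow> real" where
  "frag_integrand \<alpha> \<gamma> \<kappa> \<phi> x =
     \<alpha> * x powr \<gamma> * (- \<phi> x + (LINT z:{0..1}|\<kappa>. \<phi> (x * z)))"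

(* Non-negative measure-valued solutions.  The integrability conditions express that all
   integrals in the weak formulation are meaningful; the Bochner integral of a
   non-integrable function is 0 by convention. *)
definition measure_valued_solution ::
  "real \<Rightarrow> real \<Rightarrow> real measure \<Rightarrow> real measure \<Rightarrow> (real \<Rightarrow> real measure) \<Rightarrow> bool" where
  "measure_valued_solution \<alpha> \<gamma> \<kappa> \<mu>0 \<mu> \<longleftrightarrow>
     (\<forall>t\<ge>0. \<mu> t \<in> radon_plus) \<and>
     (\<forall>\<phi>::real \<Rightarrow> real. continuous_on {0..} \<phi> \<and> bounded (\<phi> ` {0..}) \<longrightarrow>
        continuous_on {0..} (\<lambda>t. LINT x:{0..}|\<mu> t. \<phi> x)) \<and>
     \<mu> 0 = \<mu>0 \<and>
     (\<forall>\<phi> t. test_function \<phi> \<and> 0 \<le> t \<longrightarrow>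
        set_integrable \<mu>0 {0..} \<phi> \<and>
        set_integrable (\<mu> t) {0..} \<phi> \<and>
        (\<forall>s\<in>{0..t}. set_integrable (\<mu> s) {0..} (frag_integrand \<alpha> \<gamma> \<kappa> \<phi>)) \<and>
        set_integrable lborel {0..t}
          (\<lambda>s. LINT x:{0..}|\<mu> s. frag_integrand \<alpha> \<gamma> \<kappa> \<phi> x) \<and>
        (LINT x:{0..}|\<mu> t. \<phi> x) =
          (LINT x:{0..}|\<mu>0. \<phi> x) +
          (LINT s:{0..t}|lborel. LINT x:{0..}|\<mu> s. frag_integrand \<alpha> \<gamma> \<kappa> \<phi> x))"

definition tv_continuous :: "(real \<Rightarrow> real measure) \<Rightarrow> bool" where
  "tv_continuous \<mu> \<longleftrightarrow>
     (\<forall>t\<ge>0. ((\<lambda>s. tv_dist (\<mu> s) (\<mu> t)) \<longlongrightarrow> 0) (at t within {0..}))"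

definition mellin :: "real measure \<Rightarrow> real \<Rightarrow> real" where
  "mellin M s = (LINT x:{0..}|M. x powr (s - 1))"

definition mellin_damped ::
  "real \<Rightarrow> real \<Rightarrow> (real \<Rightarrow> real measure) \<Rightarrow> real \<Rightarrow> real \<Rightarrow> real \<Rightarrow> real" where
  "mellin_damped \<alpha> \<gamma> \<mu> t h s =
     (LINT x:{0..}|\<mu> t. x powr (s - 1) * exp (- \<alpha> * h * x powr \<gamma>))"

definition K_est ::
  "real \<Rightarrow> real \<Rightarrow> (real \<Rightarrow> real measure) \<Rightarrow> real \<Rightarrow> real \<Rightarrow> real \<Rightarrow> real" where
  "K_est \<alpha> \<gamma> \<mu> s t \<Delta> =
     (mellin (\<mu> (t + \<Delta>)) s - mellin_damped \<alpha> \<gamma> \<mu> t \<Delta> s) /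
     (\<alpha> * \<Delta> * mellin (\<mu> t) (s + \<gamma>))"

definition half_kernel_var :: "real measure \<Rightarrow> real" where
  "half_kernel_var \<kappa> = 1/2 * mellin \<kappa> 3 - 1/4"

definition half_kernel_var_est ::
  "real \<Rightarrow> real \<Rightarrow> (real \<Rightarrow> real measure) \<Rightarrow> real \<Rightarrow> real \<Rightarrow> real" where
  "half_kernel_var_est \<alpha> \<gamma> \<mu> t \<Delta> = 1/2 * K_est \<alpha> \<gamma> \<mu> 3 t \<Delta> - 1/4"

(* Absolute continuity of a function on [a,b] (as opposed to the library's notion for measures). *)
definition abs_continuous_fun ::
  "real \<Rightarrow> real \<Rightarrow> (real \<Rightarrow> 'a::metric_space) \<Rightarrow> bool" where
  "abs_continuous_fun a b f \<longleftrightarrow>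
     (\<forall>\<epsilon>>0. \<exists>\<delta>>0. \<forall>n (l::nat \<Rightarrow> real) r.
        (\<forall>i<n. a \<le> l i \<and> l i \<le> r i \<and> r i \<le> b) \<and>
        disjoint_family_on (\<lambda>i. {l i<..<r i}) {..<n} \<and>
        (\<Sum>i<n. r i - l i) < \<delta> \<longrightarrow>
        (\<Sum>i<n. dist (f (l i)) (f (r i))) < \<epsilon>)"

(* k is the density on [0,1] of the kernel; the values of k off [0,1] are irrelevant. *)
definition kernel_density :: "real measure \<Rightarrow> (real \<Rightarrow> real) \<Rightarrow> bool" where
  "kernel_density \<kappa> k \<longleftrightarrow>
     (\<forall>x\<in>{0..1}. 0 \<le> k x) \<and>
     set_borel_measurable borel {0..1} k \<and>
     \<kappa> = density lborel (\<lambda>x. ennreal (indicator {0..1} x * k x))"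

definition regular_kernel_density :: "(real \<Rightarrow> real) \<Rightarrow> bool" where
  "regular_kernel_density k \<longleftrightarrow>
     (\<exists>I. is_interval I \<and> interior I \<noteq> {} \<and> I \<subseteq> {0<..} \<and>
        abs_continuous_fun 0 1 k \<and>
        (\<forall>s::complex. Re s \<in> I \<longrightarrow>
           abs_continuous_fun 0 1
             (\<lambda>x. inverse s * complex_of_real x powr s * complex_of_real (k x))))"

(* C^n on a set S; on a closed interval the derivatives at the end points are one-sided. *)
definition C_on :: "nat \<Rightarrow> (real \<Rightarrow> real) \<Rightarrow> real set \<Rightarrow> bool" where
  "C_on n f S \<longleftrightarrow>
     (\<exists>D. (\<forall>x\<in>S. D 0 x = f x) \<and>
        (\<forall>i<n. \<forall>x\<in>S. (D i has_real_derivative D (Suc i) x) (at x within S)) \<and>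
        continuous_on S (D n))"

definition initial_density :: "real \<Rightarrow> (real \<Rightarrow> real) \<Rightarrow> bool" where
  "initial_density L u0 \<longleftrightarrow>
     (\<forall>x. 0 \<le> u0 x) \<and> closure {x. u0 x \<noteq> 0} \<subseteq> {0..L} \<and> C_on 3 u0 {0..L} \<and>
     (u0 L > 0 \<or>
      u0 L = 0 \<and> (\<exists>d<0. (u0 has_real_derivative d) (at L within {0..L})))"

end

theory Submission
  imports Defs
begin

text \<open>
  The variance is an affine function of the moment \<open>K(3)\<close>, so the point is to bound
  \<open>\<bar>K(s) - K\<^sup>e\<^sup>s\<^sup>t(s,t,\<Delta>)\<bar>\<close> for \<open>s = 3\<close>. Write \<open>U(t,s)\<close> for the moments of the solution
  and \<open>V = U(t,s+\<gamma>)\<close>. Everything rests on three facts.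

  \<^item> Fragments are smaller than their parents, so \<open>\<mu>\<^sub>t\<close> stays carried by \<open>[0,L]\<close>
    (\<open>solution_support\<close>). Hence powers can be used as test functions after truncation at \<open>L\<close>,
    which gives the closed moment equation
    \<open>\<partial>\<^sub>t U(t,s) = \<alpha> (K(s) - 1) U(t,s+\<gamma>)\<close> in integrated form (\<open>moment_evolution\<close>), and
    \<open>U(t,s+\<gamma>) \<le> L\<^sup>\<gamma> U(t,s)\<close> (\<open>moment_shift_le\<close>).

  \<^item> For \<open>s \<ge> 2\<close> mass conservation of the kernel gives \<open>0 \<le> K(s) \<le> 1\<close>. So \<open>U(\<sqdot>,s)\<close> decreases,
    but by at most the fraction \<open>\<alpha> L\<^sup>\<gamma> \<Delta>\<close> during a time \<open>\<Delta>\<close>, measured relative to its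
    own value at the start (\<open>moment_decrease_le\<close>). In particular the denominator \<open>V\<close> of the
    estimator never vanishes (\<open>moment_pos\<close>).

  \<^item> Expanding the exponential to first order, \<open>U(t,s) - W(t,\<Delta>,s) = \<alpha>\<Delta>V\<close> up to an error of at
    most \<open>(\<alpha>\<Delta>)\<^sup>2 L\<^sup>\<gamma> V\<close> (\<open>damped_moment_expansion\<close>).

  By the moment equation and the slow decrease of \<open>U(\<sqdot>,s+\<gamma>)\<close>,
  \<open>U(t+\<Delta>,s) - U(t,s) = (K(s) - 1) \<alpha>\<Delta>V\<close> with an error of the same size. Adding the last two
  relations, the numerator of the estimator is \<open>K(s) \<alpha>\<Delta>V\<close> up to \<open>2 (\<alpha>\<Delta>)\<^sup>2 L\<^sup>\<gamma> V\<close>; division by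
  \<open>\<alpha>\<Delta>V\<close> leaves the error \<open>2 L\<^sup>\<gamma> \<alpha>\<Delta>\<close>, which the factor
  \<open>1/2\<close> in the variance halves. All errors are relative to \<open>V\<close>, which is why the constant
  \<open>C = L\<^sup>\<gamma>\<close> depends neither on the initial datum nor on the kernel.
\<close>

section \<open>Integrals against finite Borel measures on the line\<close>

lemma continuous_set_integrable_finite_measure:
  fixes g :: "real \<Rightarrow> real"
  assumes M: "finite_measure M" "sets M = sets borel" and g: "continuous_on {a..b} g"
  shows "set_integrable M {a..b} g"
proof -
  interpret finite_measure M by fact
  have "compact (g ` {a..b})"
    using g by (intro compact_continuous_image) auto
  then obtain B where B: "\<And>x. x \<in> {a..b} \<Longrightarrow> \<bar>g x\<bar> \<le> B"
    by (metis bounded_iff compact_imp_bounded imageI real_norm_def)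
  have "(\<lambda>x. indicator {a..b} x *\<^sub>R g x) \<in> borel_measurable borel"
    using g by (intro borel_measurable_continuous_on_indicator) auto
  hence "(\<lambda>x. indicator {a..b} x *\<^sub>R g x) \<in> borel_measurable M"
    using measurable_cong_sets[OF M(2) refl] by blast
  moreover have "AE x in M. norm (indicator {a..b} x *\<^sub>R g x) \<le> \<bar>B\<bar>"
    using B by (intro always_eventually) (fastforce simp: indicator_def)
  ultimately show ?thesis
    unfolding set_integrable_def by (intro integrable_const_bound)
qed

lemma continuous_on_powr_const:
  assumes "0 < (p::real)" "S \<subseteq> {0..}"
  shows "continuous_on S (\<lambda>x::real. x powr p)"
  using assms by (intro continuous_on_powr') (auto intro: continuous_intros)

lemma set_lebesgue_integral_cong_AE_borel:
  fixes f g :: "real \<Rightarrow> real"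
  assumes "sets M = sets borel" "f \<in> borel_measurable borel" "g \<in> borel_measurable borel"
    and "A \<in> sets borel" "B \<in> sets borel"
    and "AE x in M. indicator A x *\<^sub>R f x = indicator B x *\<^sub>R g x"
  shows "(LINT x:A|M. f x) = (LINT x:B|M. g x)"
proof -
  have [measurable_cong]: "sets M = sets borel" by fact
  note [measurable] = assms(2-5)
  show ?thesis
    unfolding set_lebesgue_integral_def using assms(6) by (intro integral_cong_AE) auto
qed

lemma set_integral_nonpos:
  fixes f :: "'a \<Rightarrow> real"
  assumes "\<And>x. x \<in> A \<Longrightarrow> f x \<le> 0"
  shows "(LINT x:A|M. f x) \<le> 0"
proof -
  have "0 \<le> (LINT x|M. - (indicator A x *\<^sub>R f x))"
    using assms by (intro Bochner_Integration.integral_nonneg) (simp add: indicator_def)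
  thus ?thesis by (simp add: set_lebesgue_integral_def)
qed

section \<open>Solutions with compactly supported initial measure\<close>

locale fragmentation_solution =
  fixes \<alpha> \<gamma> L :: real and \<kappa> \<mu>0 :: "real measure" and \<mu> :: "real \<Rightarrow> real measure"
  assumes alpha: "\<alpha> > 0" and gamma: "\<gamma> > 0" and L: "L > 0"
    and kernel: "fragmentation_kernel \<kappa>"
    and solution: "measure_valued_solution \<alpha> \<gamma> \<kappa> \<mu>0 \<mu>"
    and initial_support: "AE x in \<mu>0. x \<le> L"
begin

lemma kernel_sets: "sets \<kappa> = sets borel" and kernel_finite: "finite_measure \<kappa>"
  and kernel_mean: "(LINT z:{0..1}|\<kappa>. z) = 1"
  using kernel by (auto simp: fragmentation_kernel_def radon_plus_def)

lemma kernel_AE: "AE z in \<kappa>. z \<in> {0..1}"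
proof (rule AE_I)
  show "emeasure \<kappa> (- {0..1}) = 0" "- {0..1} \<in> sets \<kappa>"
    using kernel by (auto simp: fragmentation_kernel_def kernel_sets)
qed auto

lemma kernel_integrable: "continuous_on {0..1} g \<Longrightarrow> set_integrable \<kappa> {0..1} (g :: real \<Rightarrow> real)"
  by (rule continuous_set_integrable_finite_measure[OF kernel_finite kernel_sets])

lemma kernel_mellin:
  assumes "s > 1" shows "mellin \<kappa> s = (LINT z:{0..1}|\<kappa>. z powr (s - 1))"
  unfolding mellin_def
  using kernel_AE by (intro set_lebesgue_integral_cong_AE_borel kernel_sets)
    (auto simp: indicator_def)

text \<open>On \<open>[0,1]\<close> one has \<open>z\<^bsup>s-1\<^esup> \<le> z\<close> when \<open>s \<ge> 2\<close>, and \<open>\<integral>z d\<kappa> = 1\<close>.\<close>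
lemma kernel_mellin_bounds:
  assumes "s \<ge> 2" shows "0 \<le> mellin \<kappa> s" "mellin \<kappa> s \<le> 1"
proof -
  have s: "s > 1" using assms by simp
  show "0 \<le> mellin \<kappa> s"
    unfolding mellin_def set_lebesgue_integral_def by (intro Bochner_Integration.integral_nonneg) auto
  have "(LINT z:{0..1}|\<kappa>. z powr (s - 1)) \<le> (LINT z:{0..1}|\<kappa>. z)"
  proof (rule set_integral_mono)
    fix z :: real assume "z \<in> {0..1}"
    thus "z powr (s - 1) \<le> z"
      using powr_mono'[of 1 "s - 1" z] assms by auto
  qed (use s in \<open>auto intro!: kernel_integrable continuous_on_powr_const\<close>)
  thus "mellin \<kappa> s \<le> 1" using kernel_mellin[OF s] kernel_mean by simp
qed

lemma solution_sets: "t \<ge> 0 \<Longrightarrow> sets (\<mu> t) = sets borel"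
  and solution_finite: "t \<ge> 0 \<Longrightarrow> finite_measure (\<mu> t)"
  using solution by (auto simp: measure_valued_solution_def radon_plus_def)

lemma solution_AE_nonneg:
  assumes "t \<ge> 0" shows "AE x in \<mu> t. x \<ge> 0"
proof (rule AE_I)
  show "emeasure (\<mu> t) (- {0..}) = 0" "- {0..} \<in> sets (\<mu> t)"
    using solution assms by (auto simp: measure_valued_solution_def radon_plus_def)
qed auto

lemma initial: "\<mu> 0 = \<mu>0"
  using solution by (simp add: measure_valued_solution_def)

lemma weak_formulation:
  assumes "test_function \<phi>" "t \<ge> 0"
  shows "(LINT x:{0..}|\<mu> t. \<phi> x) = (LINT x:{0..}|\<mu>0. \<phi> x) +
          (LINT s:{0..t}|lborel. LINT x:{0..}|\<mu> s. frag_integrand \<alpha> \<gamma> \<kappa> \<phi> x)"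
    and "set_integrable (\<mu> t) {0..} \<phi>"
    and "set_integrable lborel {0..t} (\<lambda>s. LINT x:{0..}|\<mu> s. frag_integrand \<alpha> \<gamma> \<kappa> \<phi> x)"
  using solution assms unfolding measure_valued_solution_def by auto

text \<open>
  Test with \<open>\<phi>(x) = max(x - L, 0)\<close>, which has linear growth and vanishes exactly on
  \<open>[0,L]\<close>. Since \<open>\<phi>\<close> is convex with \<open>\<phi>(0) = 0\<close>, \<open>\<phi>(xz) \<le> z \<phi>(x)\<close> for \<open>z \<in> [0,1]\<close>; integrating
  in \<open>z\<close>, the gain is at most the loss and \<open>\<integral>\<phi> d\<mu>\<^sub>t\<close> cannot become positive.
\<close>
lemma solution_support:
  assumes t: "t \<ge> 0" shows "AE x in \<mu> t. x \<in> {0..L}"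
proof -
  define \<phi> where "\<phi> x = max (x - L) 0" for x :: real
  have phi_cont: "continuous_on S \<phi>" for S
    unfolding \<phi>_def by (intro continuous_intros)
  have [measurable]: "\<phi> \<in> borel_measurable borel"
    using phi_cont by (rule borel_measurable_continuous_onI)
  have phi_test: "test_function \<phi>"
    unfolding test_function_def bounded_iff
  proof (intro conjI exI[of _ 1] ballI)
    fix y assume "y \<in> (\<lambda>x. \<phi> x / (1 + x)) ` {0..}"
    thus "norm y \<le> 1" using L by (auto simp: \<phi>_def)
  qed (rule phi_cont)
  have drift: "frag_integrand \<alpha> \<gamma> \<kappa> \<phi> x \<le> 0" if x: "x \<ge> 0" for x
  proof -
    have "(LINT z:{0..1}|\<kappa>. \<phi> (x * z)) \<le> (LINT z:{0..1}|\<kappa>. \<phi> x * z)"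
    proof (rule set_integral_mono)
      show "set_integrable \<kappa> {0..1} (\<lambda>z. \<phi> (x * z))"
        unfolding \<phi>_def by (intro kernel_integrable continuous_intros)
      show "set_integrable \<kappa> {0..1} (\<lambda>z. \<phi> x * z)"
        by (intro kernel_integrable continuous_intros)
      fix z :: real assume z: "z \<in> {0..1}"
      have "x * z - L \<le> (x - L) * z" using L z by (simp add: algebra_simps mult_left_le)
      also have "\<dots> \<le> \<phi> x * z" using z by (intro mult_right_mono) (auto simp: \<phi>_def)
      finally show "\<phi> (x * z) \<le> \<phi> x * z" using z by (simp add: \<phi>_def)
    qed
    hence "(LINT z:{0..1}|\<kappa>. \<phi> (x * z)) \<le> \<phi> x" using kernel_mean by simp
    thus ?thesis unfolding frag_integrand_def using alpha
      by (intro mult_nonneg_nonpos) auto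
  qed
  have [measurable_cong]: "sets \<mu>0 = sets borel" "sets (\<mu> t) = sets borel"
    using solution_sets[of 0] solution_sets[OF t] initial by auto
  have "(LINT x:{0..}|\<mu>0. \<phi> x) = (LINT x:{0..}|\<mu>0. 0)"
    using initial_support
    by (intro set_lebesgue_integral_cong_AE_borel) (auto simp: \<phi>_def indicator_def solution_sets[of 0, simplified initial])
  moreover have "(LINT s:{0..t}|lborel. LINT x:{0..}|\<mu> s. frag_integrand \<alpha> \<gamma> \<kappa> \<phi> x) \<le> 0"
    using drift by (intro set_integral_nonpos) auto
  ultimately have "(LINT x:{0..}|\<mu> t. \<phi> x) \<le> 0"
    using weak_formulation(1)[OF phi_test t] by simp
  moreover have "(LINT x:{0..}|\<mu> t. \<phi> x) \<ge> 0"
    unfolding set_lebesgue_integral_def by (intro Bochner_Integration.integral_nonneg) (auto simp: \<phi>_def)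
  ultimately have "(LINT x|\<mu> t. indicator {0..} x *\<^sub>R \<phi> x) = 0"
    unfolding set_lebesgue_integral_def by simp
  hence "AE x in \<mu> t. indicator {0..} x *\<^sub>R \<phi> x = 0"
    using weak_formulation(2)[OF phi_test t]
    by (subst (asm) integral_nonneg_eq_0_iff_AE) (auto simp: \<phi>_def set_integrable_def)
  with solution_AE_nonneg[OF t] show ?thesis
    by eventually_elim (auto simp: \<phi>_def indicator_def max_def split: if_splits)
qed

section \<open>Evolution of the moments\<close>

lemma solution_integrable:
  assumes t: "t \<ge> 0" and g: "continuous_on {0..L} g" "g \<in> borel_measurable borel"
  shows "set_integrable (\<mu> t) {0..} (g :: real \<Rightarrow> real)"
proof -
  have [measurable_cong]: "sets (\<mu> t) = sets borel" by (rule solution_sets[OF t])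
  note [measurable] = g(2)
  have "set_integrable (\<mu> t) {0..L} g"
    by (rule continuous_set_integrable_finite_measure[OF solution_finite[OF t] solution_sets[OF t] g(1)])
  moreover have "AE x in \<mu> t. indicator {0..L} x *\<^sub>R g x = indicator {0..} x *\<^sub>R g x"
    using solution_support[OF t] by eventually_elim (auto simp: indicator_def)
  ultimately show ?thesis
    unfolding set_integrable_def by (subst (asm) integrable_cong_AE) auto
qed

lemma solution_integral_mono:
  assumes t: "t \<ge> 0" and f: "continuous_on {0..L} f" "f \<in> borel_measurable borel"
    and g: "continuous_on {0..L} g" "g \<in> borel_measurable borel"
    and le: "\<And>x. x \<in> {0..L} \<Longrightarrow> f x \<le> (g x :: real)"
  shows "(LINT x:{0..}|\<mu> t. f x) \<le> (LINT x:{0..}|\<mu> t. g x)"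
  unfolding set_lebesgue_integral_def
proof (rule integral_mono_AE)
  show "AE x in \<mu> t. indicator {0..} x *\<^sub>R f x \<le> indicator {0..} x *\<^sub>R g x"
    using solution_support[OF t] by eventually_elim (auto simp: le)
qed (use solution_integrable[OF t f] solution_integrable[OF t g] in \<open>auto simp: set_integrable_def\<close>)

abbreviation U :: "real \<Rightarrow> real \<Rightarrow> real" where "U t s \<equiv> mellin (\<mu> t) s"

lemma moment_nonneg: "0 \<le> U t s"
  unfolding mellin_def set_lebesgue_integral_def by (intro Bochner_Integration.integral_nonneg) auto

lemma moment_shift_le:
  assumes t: "t \<ge> 0" and s: "s > 1"
  shows "U t (s + \<gamma>) \<le> L powr \<gamma> * U t s"
proof -
  have "U t (s + \<gamma>) \<le> (LINT x:{0..}|\<mu> t. L powr \<gamma> * x powr (s - 1))"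
    unfolding mellin_def
  proof (rule solution_integral_mono[OF t])
    fix x assume x: "x \<in> {0..L}"
    have "x powr (s + \<gamma> - 1) = x powr \<gamma> * x powr (s - 1)"
      by (simp flip: powr_add add: algebra_simps)
    also have "\<dots> \<le> L powr \<gamma> * x powr (s - 1)"
      using x gamma by (intro mult_right_mono powr_mono2) auto
    finally show "x powr (s + \<gamma> - 1) \<le> L powr \<gamma> * x powr (s - 1)" .
  qed (use s gamma in \<open>auto intro!: continuous_intros continuous_on_powr_const\<close>)
  thus ?thesis by (simp add: mellin_def)
qed

text \<open>
  A power \<open>x\<^bsup>s-1\<^esup>\<close> with \<open>s > 2\<close> grows faster than the test functions may. Truncation at \<open>L\<close> makes
  it bounded without changing its integral, because \<open>\<mu>\<^sub>t\<close> lives on \<open>[0,L]\<close>.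
\<close>
lemma truncated_power_moment:
  assumes t: "t \<ge> 0"
  shows "(LINT x:{0..}|\<mu> t. min x L powr (s - 1)) = U t s"
  unfolding mellin_def using solution_support[OF t]
  by (intro set_lebesgue_integral_cong_AE_borel solution_sets t) (auto simp: indicator_def)

lemma truncated_power_continuous:
  assumes "s > 1" shows "continuous_on {0..} (\<lambda>x. min x L powr (s - 1))"
  using assms L by (intro continuous_on_powr') (auto intro: continuous_intros)

lemma truncated_power_bound:
  assumes "s > 1" "x \<ge> 0" shows "min x L powr (s - 1) \<le> L powr (s - 1)"
  using assms L by (intro powr_mono2) auto

lemma moment_continuous:
  assumes s: "s > 1" shows "continuous_on {0..} (\<lambda>t. U t s)"
proof -
  have "bounded ((\<lambda>x. min x L powr (s - 1)) ` {0..})"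
    unfolding bounded_iff using truncated_power_bound[OF s] by auto
  hence "continuous_on {0..} (\<lambda>t. LINT x:{0..}|\<mu> t. min x L powr (s - 1))"
    using solution truncated_power_continuous[OF s] unfolding measure_valued_solution_def by blast
  thus ?thesis
    by (rule continuous_on_eq) (use truncated_power_moment in auto)
qed

text \<open>
  For \<open>x \<in> [0,L]\<close> the fragments \<open>xz\<close> lie in \<open>[0,L]\<close> too, where the truncated power is a genuine
  power; multiplicativity then factors the gain as \<open>x\<^bsup>s-1\<^esup> K(s)\<close>, and the weak formulation
  closes in terms of moments.
\<close>
lemma moment_evolution_from_0:
  assumes s: "s > 1" and t: "t \<ge> 0"
  shows "U t s - U 0 s = \<alpha> * (mellin \<kappa> s - 1) * integral {0..t} (\<lambda>r. U r (s + \<gamma>))"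
proof -
  define \<phi> where "\<phi> x = min x L powr (s - 1)" for x
  have [measurable]: "\<phi> \<in> borel_measurable borel"
    unfolding \<phi>_def by measurable
  have "\<phi> x / (1 + x) \<le> L powr (s - 1)" if "x \<ge> 0" for x
  proof -
    have "\<phi> x \<le> L powr (s - 1)" using truncated_power_bound[OF s that] by (simp add: \<phi>_def)
    also have "\<dots> \<le> L powr (s - 1) * (1 + x)" using that by (simp add: algebra_simps)
    finally show ?thesis using that by (simp add: divide_simps)
  qed
  hence test: "test_function \<phi>"
    using truncated_power_continuous[OF s]
    by (auto simp: test_function_def bounded_iff \<phi>_def intro!: exI[of _ "L powr (s - 1)"])
  have fragments: "frag_integrand \<alpha> \<gamma> \<kappa> \<phi> x =
      \<alpha> * (mellin \<kappa> s - 1) * min x L powr (s + \<gamma> - 1)" if x: "x \<in> {0..L}" for x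
  proof -
    have "(LINT z:{0..1}|\<kappa>. \<phi> (x * z)) = (LINT z:{0..1}|\<kappa>. x powr (s - 1) * z powr (s - 1))"
    proof (rule set_lebesgue_integral_cong)
      show "\<forall>z. z \<in> {0..1} \<longrightarrow> \<phi> (x * z) = x powr (s - 1) * z powr (s - 1)"
      proof safe
        fix z :: real assume z: "z \<in> {0..1}"
        have "x * z \<le> x * 1" using x z by (intro mult_left_mono) auto
        thus "\<phi> (x * z) = x powr (s - 1) * z powr (s - 1)"
          using x z by (simp add: \<phi>_def powr_mult)
      qed
    qed (simp add: kernel_sets)
    hence "(LINT z:{0..1}|\<kappa>. \<phi> (x * z)) = x powr (s - 1) * mellin \<kappa> s"
      using kernel_mellin[OF s] by simp
    moreover have "x powr (s + \<gamma> - 1) = x powr \<gamma> * x powr (s - 1)"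
      by (simp flip: powr_add add: algebra_simps)
    ultimately show ?thesis
      using x by (simp add: frag_integrand_def \<phi>_def algebra_simps)
  qed
  have flux: "(LINT x:{0..}|\<mu> r. frag_integrand \<alpha> \<gamma> \<kappa> \<phi> x) = \<alpha> * (mellin \<kappa> s - 1) * U r (s + \<gamma>)"
    if r: "r \<in> {0..t}" for r
  proof -
    have r0: "r \<ge> 0" using r by simp
    have [measurable_cong]: "sets (\<mu> r) = sets borel" by (rule solution_sets[OF r0])
    have "set_integrable (\<mu> r) {0..} (frag_integrand \<alpha> \<gamma> \<kappa> \<phi>)"
      using solution test r t unfolding measure_valued_solution_def by blast
    hence "(\<lambda>x. indicator {0..} x *\<^sub>R frag_integrand \<alpha> \<gamma> \<kappa> \<phi> x) \<in> borel_measurable (\<mu> r)"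
      unfolding set_integrable_def by (rule borel_measurable_integrable)
    hence "(LINT x:{0..}|\<mu> r. frag_integrand \<alpha> \<gamma> \<kappa> \<phi> x) =
        (LINT x:{0..}|\<mu> r. \<alpha> * (mellin \<kappa> s - 1) * min x L powr (s + \<gamma> - 1))"
      unfolding set_lebesgue_integral_def
    proof (rule integral_cong_AE)
      show "AE x in \<mu> r. indicator {0..} x *\<^sub>R frag_integrand \<alpha> \<gamma> \<kappa> \<phi> x =
          indicator {0..} x *\<^sub>R (\<alpha> * (mellin \<kappa> s - 1) * min x L powr (s + \<gamma> - 1))"
        using solution_support[OF r0] by eventually_elim (simp add: fragments)
    qed measurable
    also have "\<dots> = \<alpha> * (mellin \<kappa> s - 1) * U r (s + \<gamma>)"
      using truncated_power_moment[OF r0, of "s + \<gamma>"] by simp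
    finally show ?thesis .
  qed
  have "continuous_on {0..t} (\<lambda>r. U r (s + \<gamma>))"
    using s gamma by (intro continuous_on_subset[OF moment_continuous]) auto
  hence int: "set_integrable lborel {0..t} (\<lambda>r. U r (s + \<gamma>))"
    by (intro borel_integrable_compact[folded set_integrable_def] compact_Icc)
  have "(LINT r:{0..t}|lborel. LINT x:{0..}|\<mu> r. frag_integrand \<alpha> \<gamma> \<kappa> \<phi> x) =
      (LINT r:{0..t}|lborel. \<alpha> * (mellin \<kappa> s - 1) * U r (s + \<gamma>))"
    using flux by (intro set_lebesgue_integral_cong) auto
  also have "\<dots> = \<alpha> * (mellin \<kappa> s - 1) * integral {0..t} (\<lambda>r. U r (s + \<gamma>))"
    using set_borel_integral_eq_integral(2)[OF int] by simp
  finally show ?thesis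
    using weak_formulation(1)[OF test t] truncated_power_moment[OF t, of s]
      truncated_power_moment[of 0 s] initial
    by (simp add: \<phi>_def)
qed

lemma moment_integrable:
  assumes "s > 1" "0 \<le> r" shows "(\<lambda>q. U q s) integrable_on {r..t}"
  using assms by (intro integrable_continuous_interval continuous_on_subset[OF moment_continuous]) auto

lemma moment_evolution:
  assumes s: "s > 1" and r: "0 \<le> r" "r \<le> t"
  shows "U t s - U r s = \<alpha> * (mellin \<kappa> s - 1) * integral {r..t} (\<lambda>q. U q (s + \<gamma>))"
proof -
  have "integral {0..r} (\<lambda>q. U q (s + \<gamma>)) + integral {r..t} (\<lambda>q. U q (s + \<gamma>)) =
      integral {0..t} (\<lambda>q. U q (s + \<gamma>))"
    using r s gamma by (intro Henstock_Kurzweil_Integration.integral_combine moment_integrable) auto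
  from arg_cong[OF this, of "\<lambda>I. \<alpha> * (mellin \<kappa> s - 1) * I"] show ?thesis
    using moment_evolution_from_0[OF s, of r] moment_evolution_from_0[OF s, of t] r
    unfolding distrib_left by linarith
qed

lemma moment_antimono:
  assumes s: "s \<ge> 2" and r: "0 \<le> r" "r \<le> t" shows "U t s \<le> U r s"
proof -
  have "0 \<le> integral {r..t} (\<lambda>q. U q (s + \<gamma>))"
    using r s gamma by (intro integral_nonneg moment_integrable moment_nonneg) auto
  hence "\<alpha> * (mellin \<kappa> s - 1) * integral {r..t} (\<lambda>q. U q (s + \<gamma>)) \<le> 0"
    using alpha kernel_mellin_bounds(2)[OF s] by (intro mult_nonpos_nonneg mult_nonneg_nonpos) auto
  thus ?thesis using moment_evolution[OF _ r, of s] s by simp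
qed

text \<open>
  The decrease over \<open>[r,t]\<close> is \<open>\<alpha> (1 - K(s)) \<integral> U(q,s+\<gamma>) dq\<close>. The integrand is at most
  \<open>L\<^sup>\<gamma> U(q,s)\<close>, and monotonicity replaces \<open>U(q,s)\<close> by its value at \<open>r\<close>. The loss is thus
  proportional to \<open>U(r,s)\<close> itself.
\<close>
lemma moment_decrease_le:
  assumes s: "s \<ge> 2" and r: "0 \<le> r" "r \<le> t"
  shows "U r s - U t s \<le> \<alpha> * L powr \<gamma> * (t - r) * U r s"
proof -
  have "integral {r..t} (\<lambda>q. U q (s + \<gamma>)) \<le> integral {r..t} (\<lambda>q. L powr \<gamma> * U r s)"
  proof (rule integral_le)
    fix q assume q: "q \<in> {r..t}"
    have "U q (s + \<gamma>) \<le> L powr \<gamma> * U q s" using q r s by (intro moment_shift_le) auto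
    also have "\<dots> \<le> L powr \<gamma> * U r s" using q r s by (intro mult_left_mono moment_antimono) auto
    finally show "U q (s + \<gamma>) \<le> L powr \<gamma> * U r s" .
  qed (use r s gamma in \<open>auto intro: moment_integrable\<close>)
  hence I: "integral {r..t} (\<lambda>q. U q (s + \<gamma>)) \<le> (t - r) * (L powr \<gamma> * U r s)"
    using r by (simp add: ac_simps)
  have "U r s - U t s = \<alpha> * ((1 - mellin \<kappa> s) * integral {r..t} (\<lambda>q. U q (s + \<gamma>)))"
    using moment_evolution[OF _ r, of s] s by (simp add: algebra_simps)
  also have "\<dots> \<le> \<alpha> * (1 * ((t - r) * (L powr \<gamma> * U r s)))"
    using kernel_mellin_bounds[OF s] alpha I r s gamma
    by (intro mult_left_mono mult_mono integral_nonneg moment_integrable moment_nonneg) auto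
  finally show ?thesis by (simp add: algebra_simps)
qed

text \<open>
  A step in time of length \<open>h = 1 / (2 \<alpha> L\<^sup>\<gamma>)\<close> costs at most half of the moment, so it remains
  positive at all multiples of \<open>h\<close>, and in between by monotonicity.
\<close>
lemma moment_pos:
  assumes s: "s \<ge> 2" and pos: "U 0 s > 0" and t: "t \<ge> 0"
  shows "U t s > 0"
proof -
  define h where "h = 1 / (2 * \<alpha> * L powr \<gamma>)"
  have h: "h > 0" "\<alpha> * L powr \<gamma> * h = 1/2"
    using alpha L by (auto simp: h_def)
  have step: "U (real n * h) s > 0" for n
  proof (induction n)
    case (Suc n)
    have "U (real n * h) s - U (real (Suc n) * h) s
        \<le> \<alpha> * L powr \<gamma> * (real (Suc n) * h - real n * h) * U (real n * h) s"
      using h(1) by (intro moment_decrease_le s) auto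
    also have "real (Suc n) * h - real n * h = h" by (simp add: algebra_simps)
    finally show ?case using Suc h(2) by simp
  qed (use pos in simp)
  obtain n where "t < real n * h" using h(1) reals_Archimedean3 by blast
  hence "U (real n * h) s \<le> U t s" using t by (intro moment_antimono[OF s]) auto
  with step[of n] show ?thesis by simp
qed

section \<open>Error of the estimator\<close>

text \<open>
  With \<open>y = \<alpha>\<Delta>x\<^sup>\<gamma>\<close>, integrate \<open>1 - y \<le> e\<^bsup>-y\<^esup> \<le> 1 - y + y\<^sup>2\<close> against \<open>x\<^bsup>s-1\<^esup> d\<mu>\<^sub>t\<close>. In the quadratic term
  one factor \<open>x\<^sup>\<gamma>\<close> is bounded by \<open>L\<^sup>\<gamma>\<close>, so that only the moment of order \<open>s + \<gamma>\<close> is left.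
\<close>
lemma damped_moment_expansion:
  assumes s: "s \<ge> 2" and t: "t \<ge> 0" and D: "\<Delta> > 0"
  shows "\<bar>U t s - mellin_damped \<alpha> \<gamma> \<mu> t \<Delta> s - \<alpha> * \<Delta> * U t (s + \<gamma>)\<bar>
    \<le> (\<alpha> * \<Delta>)\<^sup>2 * L powr \<gamma> * U t (s + \<gamma>)"
proof -
  define a where "a = \<alpha> * \<Delta>"
  define f where "f x = x powr (s - 1) - a * x powr (s + \<gamma> - 1)" for x
  define g where "g x = a\<^sup>2 * L powr \<gamma> * x powr (s + \<gamma> - 1)" for x
  define w where "w x = x powr (s - 1) * exp (- \<alpha> * \<Delta> * x powr \<gamma>)" for x
  have a: "a > 0" using alpha D by (simp add: a_def)
  have cont: "continuous_on {0..L} (\<lambda>x. x powr (s - 1))" "continuous_on {0..L} (\<lambda>x. x powr (s + \<gamma> - 1))"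
    "continuous_on {0..L} (\<lambda>x. x powr \<gamma>)"
    using s gamma by (auto intro!: continuous_on_powr_const)
  have fc: "continuous_on {0..L} f" and gc: "continuous_on {0..L} g" and wc: "continuous_on {0..L} w"
    unfolding f_def g_def w_def by (intro continuous_intros cont)+
  have [measurable]: "f \<in> borel_measurable borel" "g \<in> borel_measurable borel" "w \<in> borel_measurable borel"
    unfolding f_def g_def w_def by measurable
  have I: "set_integrable (\<mu> t) {0..} (\<lambda>x. x powr (s - 1))"
    "set_integrable (\<mu> t) {0..} (\<lambda>x. a * x powr (s + \<gamma> - 1))"
    by (intro solution_integrable t cont continuous_intros; measurable)+
  have f_int: "(LINT x:{0..}|\<mu> t. f x) = U t s - a * U t (s + \<gamma>)"
    unfolding f_def mellin_def by (subst set_integral_diff(2)[OF I]) simp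
  have g_int: "(LINT x:{0..}|\<mu> t. g x) = a\<^sup>2 * L powr \<gamma> * U t (s + \<gamma>)"
    unfolding g_def mellin_def by simp
  have fg: "(LINT x:{0..}|\<mu> t. f x + g x) = (LINT x:{0..}|\<mu> t. f x) + (LINT x:{0..}|\<mu> t. g x)"
    by (intro set_integral_add solution_integrable t fc gc) measurable
  have pointwise: "f x \<le> w x" "w x \<le> f x + g x" if x: "x \<in> {0..L}" for x
  proof -
    define y where "y = a * x powr \<gamma>"
    have y: "y \<ge> 0" using a by (simp add: y_def)
    have w: "w x = x powr (s - 1) * exp (- y)" by (simp add: w_def y_def a_def mult.assoc)
    have f: "f x = x powr (s - 1) * (1 - y)"
      by (simp add: f_def y_def algebra_simps flip: powr_add)
    show "f x \<le> w x" unfolding f w using exp_ge_add_one_self[of "- y"] by (intro mult_left_mono) auto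
    \<comment> \<open>The upper bound follows from \<open>e\<^sup>y \<ge> 1 + y\<close> and \<open>(1 - y + y\<^sup>2) (1 + y) = 1 + y\<^sup>3\<close>.\<close>
    have "1 \<le> 1 + y ^ 3" using y by simp
    also have "\<dots> = (1 - y + y\<^sup>2) * (1 + y)" by (simp add: algebra_simps power2_eq_square power3_eq_cube)
    also have "\<dots> \<le> (1 - y + y\<^sup>2) * exp y"
    proof (intro mult_left_mono exp_ge_add_one_self)
      have "1 - y + y\<^sup>2 = (1 - y / 2)\<^sup>2 + 3 / 4 * y\<^sup>2" by (simp add: power2_eq_square algebra_simps)
      thus "0 \<le> 1 - y + y\<^sup>2" by simp
    qed
    finally have "exp (- y) \<le> 1 - y + y\<^sup>2" by (simp add: exp_minus divide_simps)
    hence "w x \<le> x powr (s - 1) * (1 - y + y\<^sup>2)" unfolding w by (intro mult_left_mono) auto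
    also have "\<dots> = f x + x powr (s - 1) * y\<^sup>2" by (simp add: f algebra_simps)
    also have "x powr (s - 1) * y\<^sup>2 = a\<^sup>2 * x powr \<gamma> * x powr (s + \<gamma> - 1)"
      by (simp add: y_def power2_eq_square powr_add[symmetric] algebra_simps) 
    also have "\<dots> \<le> g x"
      unfolding g_def using x gamma by (intro mult_right_mono mult_left_mono powr_mono2) auto
    finally show "w x \<le> f x + g x" by simp
  qed
  have "(LINT x:{0..}|\<mu> t. f x) \<le> (LINT x:{0..}|\<mu> t. w x)"
    by (intro solution_integral_mono t fc wc pointwise) measurable
  moreover have "(LINT x:{0..}|\<mu> t. w x) \<le> (LINT x:{0..}|\<mu> t. f x + g x)"
    by (intro solution_integral_mono t fc gc wc continuous_intros pointwise) measurable
  moreover have "mellin_damped \<alpha> \<gamma> \<mu> t \<Delta> s = (LINT x:{0..}|\<mu> t. w x)"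
    by (simp add: mellin_damped_def w_def)
  ultimately show ?thesis unfolding fg f_int g_int a_def[symmetric] by linarith
qed

text \<open>
  In the notation of the proof the numerator of the estimator is exactly \<open>k a V + E + F\<close>: \<open>E\<close> is
  the error of freezing the moment of order \<open>s + \<gamma>\<close> at time \<open>t\<close> in the moment equation, \<open>F\<close> that
  of linearising the exponential. Both are of order \<open>a\<^sup>2 V\<close>.
\<close>
lemma kernel_moment_estimate:
  assumes s: "s \<ge> 2" and pos: "U 0 (s + \<gamma>) > 0" and t: "t \<ge> 0" and D: "\<Delta> > 0"
  shows "\<bar>mellin \<kappa> s - K_est \<alpha> \<gamma> \<mu> s t \<Delta>\<bar> \<le> 2 * L powr \<gamma> * (\<alpha> * \<Delta>)"
proof -
  define a where "a = \<alpha> * \<Delta>"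
  define V where "V = U t (s + \<gamma>)"
  define k where "k = mellin \<kappa> s"
  define J where "J = integral {t..t + \<Delta>} (\<lambda>q. U q (s + \<gamma>))"
  define M where "M = L powr \<gamma>"
  have a: "a > 0" using alpha D by (simp add: a_def)
  have V: "V > 0" unfolding V_def using s gamma pos t by (auto intro: moment_pos)
  have k: "0 \<le> k" "k \<le> 1" unfolding k_def using kernel_mellin_bounds[OF s] by auto
  have near: "V - a * M * V \<le> U q (s + \<gamma>)" "U q (s + \<gamma>) \<le> V" if q: "q \<in> {t..t + \<Delta>}" for q
  proof -
    show "U q (s + \<gamma>) \<le> V" unfolding V_def using q s t gamma by (intro moment_antimono) auto
    have "V - U q (s + \<gamma>) \<le> \<alpha> * M * (q - t) * V"
      unfolding V_def M_def using q s t gamma by (intro moment_decrease_le) auto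
    also have "\<dots> \<le> \<alpha> * M * \<Delta> * V"
      using q alpha V by (intro mult_right_mono mult_left_mono) (auto simp: M_def)
    finally show "V - a * M * V \<le> U q (s + \<gamma>)" by (simp add: a_def algebra_simps)
  qed
  have int: "(\<lambda>q. U q (s + \<gamma>)) integrable_on {t..t + \<Delta>}"
    using s t gamma by (intro moment_integrable) auto
  have "integral {t..t + \<Delta>} (\<lambda>q. V - a * M * V) \<le> J" "J \<le> integral {t..t + \<Delta>} (\<lambda>q. V)"
    unfolding J_def by (intro integral_le int near; auto)+
  hence J: "\<Delta> * (V - a * M * V) \<le> J" "J \<le> \<Delta> * V" using D by auto
  define E where "E = (1 - k) * (a * V - \<alpha> * J)"
  have d: "0 \<le> a * V - \<alpha> * J" "a * V - \<alpha> * J \<le> a\<^sup>2 * M * V"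
    using mult_left_mono[OF J(1), of \<alpha>] mult_left_mono[OF J(2), of \<alpha>] alpha
    by (auto simp: a_def algebra_simps power2_eq_square)
  have E: "0 \<le> E" "E \<le> a\<^sup>2 * M * V"
    using k d mult_mono[of "1 - k" 1 "a * V - \<alpha> * J" "a\<^sup>2 * M * V"] by (auto simp: E_def)
  define F where "F = U t s - mellin_damped \<alpha> \<gamma> \<mu> t \<Delta> s - a * V"
  have F: "\<bar>F\<bar> \<le> a\<^sup>2 * M * V"
    using damped_moment_expansion[OF s t D] by (simp add: F_def a_def V_def M_def)
  have "U (t + \<Delta>) s - U t s = \<alpha> * (k - 1) * J"
    unfolding k_def J_def using s t D by (intro moment_evolution) auto
  hence num: "U (t + \<Delta>) s - mellin_damped \<alpha> \<gamma> \<mu> t \<Delta> s = k * (a * V) + (E + F)"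
    by (simp add: E_def F_def algebra_simps)
  have "mellin \<kappa> s - K_est \<alpha> \<gamma> \<mu> s t \<Delta> = - (E + F) / (a * V)"
    unfolding K_est_def num a_def[symmetric] V_def[symmetric] k_def[symmetric]
    using a V by (simp add: field_simps)
  hence "\<bar>mellin \<kappa> s - K_est \<alpha> \<gamma> \<mu> s t \<Delta>\<bar> = \<bar>E + F\<bar> / (a * V)"
    using a V by (simp add: abs_divide abs_mult)
  also have "\<dots> \<le> (2 * (a\<^sup>2 * M * V)) / (a * V)"
    using E F a V by (intro divide_right_mono) auto
  also have "\<dots> = 2 * M * a" using a V by (simp add: power2_eq_square)
  finally show ?thesis by (simp add: M_def a_def)
qed

end

section \<open>The initial density\<close>

lemma initial_density_measurable:
  assumes "initial_density L u0" shows "u0 \<in> borel_measurable borel"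
proof -
  from assms have C: "C_on 3 u0 {0..L}" and cl: "closure {x. u0 x \<noteq> 0} \<subseteq> {0..L}"
    by (auto simp: initial_density_def)
  from C obtain D where D0: "\<And>x. x \<in> {0..L} \<Longrightarrow> D 0 x = u0 x"
    and D: "\<And>i x. i < 3 \<Longrightarrow> x \<in> {0..L} \<Longrightarrow> (D i has_real_derivative D (Suc i) x) (at x within {0..L})"
    unfolding C_on_def by blast
  have "continuous_on {0..L} (D 0)"
    using D[of 0] by (intro DERIV_continuous_on) auto
  hence "continuous_on {0..L} u0" using D0 continuous_on_cong by (metis (no_types, lifting))
  hence "(\<lambda>x. indicator {0..L} x *\<^sub>R u0 x) \<in> borel_measurable borel"
    by (intro borel_measurable_continuous_on_indicator) auto
  moreover have "(\<lambda>x. indicator {0..L} x *\<^sub>R u0 x) = u0"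
    using cl closure_subset[of "{x. u0 x \<noteq> 0}"] by (auto simp: indicator_def fun_eq_iff)
  ultimately show ?thesis by metis
qed

text \<open>
  Either alternative at the right end point, a positive value or a zero with negative one-sided
  slope, forces positivity just to the left of \<open>L\<close>. This is what keeps the initial measure, and
  with it the denominator of the estimator, from vanishing.
\<close>
lemma initial_density_pos_near_endpoint:
  assumes u0: "initial_density L u0" and L: "L > 0"
  obtains b where "0 \<le> b" "b < L" "\<And>x. x \<in> {b<..<L} \<Longrightarrow> u0 x > 0"
proof -
  have "eventually (\<lambda>x. u0 x > 0) (at L within {0..L})"
    using u0 unfolding initial_density_def
  proof (elim conjE disjE exE)
    assume pos: "u0 L > 0" and C: "C_on 3 u0 {0..L}"
    from C obtain D where D0: "\<And>x. x \<in> {0..L} \<Longrightarrow> D 0 x = u0 x"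
      and D: "\<And>i x. i < 3 \<Longrightarrow> x \<in> {0..L} \<Longrightarrow> (D i has_real_derivative D (Suc i) x) (at x within {0..L})"
      unfolding C_on_def by blast
    have "(D 0 has_real_derivative D (Suc 0) L) (at L within {0..L})" using D[of 0 L] L by simp
    hence "(D 0 \<longlongrightarrow> D 0 L) (at L within {0..L})"
      using DERIV_continuous continuous_within by blast
    hence "eventually (\<lambda>x. D 0 x > 0) (at L within {0..L})"
      using pos D0[of L] L by (intro order_tendstoD) auto
    moreover have "eventually (\<lambda>x. x \<in> {0..L}) (at L within {0..L})"
      by (simp add: eventually_at_filter)
    ultimately show ?thesis by eventually_elim (use D0 in auto)
  next
    fix d :: real assume "d < 0" and zero: "u0 L = 0" and d: "(u0 has_real_derivative d) (at L within {0..L})"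
    have "eventually (\<lambda>x. (u0 x - u0 L) / (x - L) < 0) (at L within {0..L})"
      using d \<open>d < 0\<close> unfolding has_field_derivative_iff by (intro order_tendstoD) auto
    moreover have "eventually (\<lambda>x. x \<in> {0..L} \<and> x \<noteq> L) (at L within {0..L})"
      by (simp add: eventually_at_filter)
    ultimately show ?thesis by eventually_elim (use zero in \<open>auto simp: divide_less_0_iff\<close>)
  qed
  then obtain e where e: "e > 0" "\<And>x. x \<in> {0..L} \<Longrightarrow> x \<noteq> L \<Longrightarrow> dist x L < e \<Longrightarrow> u0 x > 0"
    unfolding eventually_at by auto
  show thesis
    by (rule that[of "max 0 (L - e)"]) (use L e in \<open>auto simp: dist_real_def\<close>)
qed

lemma initial_density_moment_pos:
  assumes u0: "initial_density L u0" and L: "L > 0"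
    and int: "set_integrable (density lborel (\<lambda>x. ennreal (u0 x))) {0..} (\<lambda>x. x powr (s - 1))"
  shows "mellin (density lborel (\<lambda>x. ennreal (u0 x))) s > 0"
proof (rule ccontr)
  let ?M = "density lborel (\<lambda>x. ennreal (u0 x))"
  have [measurable]: "u0 \<in> borel_measurable borel" using u0 by (rule initial_density_measurable)
  obtain b where b: "0 \<le> b" "b < L" "\<And>x. x \<in> {b<..<L} \<Longrightarrow> u0 x > 0"
    using initial_density_pos_near_endpoint[OF u0 L] by blast
  assume "\<not> mellin ?M s > 0"
  moreover have "mellin ?M s \<ge> 0"
    unfolding mellin_def set_lebesgue_integral_def by (intro Bochner_Integration.integral_nonneg) auto
  ultimately have "(LINT x|?M. indicator {0..} x *\<^sub>R x powr (s - 1)) = 0"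
    unfolding mellin_def set_lebesgue_integral_def by linarith
  hence "AE x in ?M. indicator {0..} x *\<^sub>R x powr (s - 1) = 0"
    using int unfolding set_integrable_def by (subst (asm) integral_nonneg_eq_0_iff_AE) auto
  hence "AE x in lborel. 0 < u0 x \<longrightarrow> indicator {0..} x *\<^sub>R x powr (s - 1) = 0"
    by (subst (asm) AE_density) auto
  hence "AE x in lborel. x \<notin> {b<..<L}"
    by eventually_elim (use b in \<open>force simp: indicator_def\<close>)
  hence "{b<..<L} \<in> null_sets lborel" by (subst AE_iff_null_sets) auto
  thus False using b by (simp add: null_sets_def)
qed

section \<open>The variance estimate\<close>

theorem corollary5:
  fixes \<alpha> \<gamma> L T \<tau>0 :: real
  assumes "\<alpha> > 0" and "\<gamma> > 0" and "L > 0" and "T > 0" and "\<tau>0 > 0"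
  shows "\<exists>C::real. \<forall>(\<kappa>::real measure) (k::real \<Rightarrow> real) (u0::real \<Rightarrow> real) (\<mu>::real \<Rightarrow> real measure).
    fragmentation_kernel \<kappa> \<and> kernel_density \<kappa> k \<and> regular_kernel_density k \<and>
    initial_density L u0 \<and>
    measure_valued_solution \<alpha> \<gamma> \<kappa> (density lborel (\<lambda>x. ennreal (u0 x))) \<mu> \<and> tv_continuous \<mu>
    \<longrightarrow> (\<forall>t\<in>{0<..<T}. \<forall>\<Delta>\<tau>\<in>{0<..<\<tau>0}.
          \<bar>half_kernel_var \<kappa> - half_kernel_var_est \<alpha> \<gamma> \<mu> t \<Delta>\<tau>\<bar> \<le> C * \<alpha> * \<Delta>\<tau>)"
proof (intro exI allI impI ballI, elim conjE)
  fix \<kappa> :: "real measure" and k u0 :: "real \<Rightarrow> real" and \<mu> :: "real \<Rightarrow> real measure" and t \<Delta> :: real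
  let ?\<mu>0 = "density lborel (\<lambda>x. ennreal (u0 x))"
  assume kernel: "fragmentation_kernel \<kappa>" and u0: "initial_density L u0"
    and sol: "measure_valued_solution \<alpha> \<gamma> \<kappa> ?\<mu>0 \<mu>"
    and t: "t \<in> {0<..<T}" and D: "\<Delta> \<in> {0<..<\<tau>0}"
  have [measurable]: "u0 \<in> borel_measurable borel" using u0 by (rule initial_density_measurable)
  have "x \<le> L" if "u0 x > 0" for x
    using u0 that closure_subset[of "{x. u0 x \<noteq> 0}"] by (force simp: initial_density_def)
  hence "AE x in ?\<mu>0. x \<le> L" by (subst AE_density) auto
  then interpret fragmentation_solution \<alpha> \<gamma> L \<kappa> ?\<mu>0 \<mu>
    using assms kernel sol by unfold_locales
  have "set_integrable ?\<mu>0 {0..} (\<lambda>x. x powr (3 + \<gamma> - 1))"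
    unfolding initial[symmetric] using gamma
    by (intro solution_integrable continuous_on_powr_const) auto
  hence "mellin ?\<mu>0 (3 + \<gamma>) > 0" using u0 L by (intro initial_density_moment_pos)
  hence "\<bar>mellin \<kappa> 3 - K_est \<alpha> \<gamma> \<mu> 3 t \<Delta>\<bar> \<le> 2 * L powr \<gamma> * (\<alpha> * \<Delta>)"
    using t D by (intro kernel_moment_estimate) (auto simp: initial)
  thus "\<bar>half_kernel_var \<kappa> - half_kernel_var_est \<alpha> \<gamma> \<mu> t \<Delta>\<bar> \<le> L powr \<gamma> * \<alpha> * \<Delta>"
    by (simp add: half_kernel_var_def half_kernel_var_est_def)
qed

end
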